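(* Let $\alpha\in[0,1]$, $\delta\in[0,1)$, $\mu\in[1,n]$, let $C\in\mathbb{S}_C$ and $u^*\in\mathbb{S}_u$. Suppose that the instance $\mathcal{MC}(C,u^* )$ satisfies the $\delta$-RIP$_{2,2}$ condition and that $u^*$ has incoherence $\mu$. Then $$\mathbb{D}_\alpha(C,u^* )\le\max\left\{\frac{n(1+\delta)}{4\alpha(1-\delta)},\frac{1}{2(1-\alpha)\mu}\right\}\times\min\left\{\left(\frac1\mu-\frac1n\right)^{-1},3\mu\right\}.$$
   Context: $\mathbb{S}_C$: the set of symmetric matrices $C\in\mathbb{R}^{n\times n}$ with nonnegative entries and $\sum_{i,j}C_{ij}=1$. $\mathbb{S}_u$: the set of $u\in\mathbb{R}^n$ with $\|u\|_1=1$. For $C\in\mathbb{S}_C$, $u^*\in\mathbb{S}_u$, the instance $\mathcal{MC}(C,u^* )$ is the problem of minimizing $g(u;C,u^* )=\sum_{i,j\in[n]}C_{ij}(u_iu_j-u_i^*u_j^* )^2$ over $u\in\mathbb{R}^n$. Degenerate set: $\mathcal{D}:=\{(C,u^* ): C\in\mathbb{S}_C, u^*\in\mathbb{S}_u, \exists u\in\mathbb{R}^n \text{ with } g(u;C,u^* )=0,\ uu^T\ne u^*(u^* )^T\}$. Complexity metric: $\mathbb{D}_\alpha(C,u^* ):=\left[\inf_{(\tilde C,\tilde u^* )\in\mathcal{D}}\alpha\|C-\tilde C\|_1+(1-\alpha)\|u^*-\tilde u^*\|_1\right]^{-1}$, with entrywise $\ell_1$-norms and the convention $1/0=+\infty$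 (used throughout). RIP: $\mathcal{MC}(C,u^* )$ satisfies $\delta$-RIP$_{2,2}$ if the function $f(M)=\sum_{i,j}C_{ij}(M_{ij}-u_i^*u_j^* )^2$ on $\mathbb{R}^{n\times n}$ does, i.e. there are $c_1,c_2\ge0$ with $c_2/c_1=(1+\delta)/(1-\delta)$ and $c_1\|K\|_F^2\le[\nabla^2f(M)](K,K)\le c_2\|K\|_F^2$ for all $M,K\in\mathbb{R}^{n\times n}$ of rank at most $2$; here $[\nabla^2 f(M)](K,K)=2\sum_{i,j}C_{ij}K_{ij}^2$. Incoherence: $u^*$ has incoherence $\mu$ (is $\mu$-incoherent) if $|u_i^*|\le\sqrt{\mu/n}\,\|u^*\|_2$ for all $i\in[n]$. *)

theory Defs
  imports "HOL-Analysis.Analysis"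
begin

(* Throughout, the dimension n is CARD('n). *)

definition vec_l1 :: "real ^ 'n \<Rightarrow> real" where
  "vec_l1 u = (\<Sum>i\<in>UNIV. \<bar>u $ i\<bar>)"

definition mat_l1 :: "real ^ 'n ^ 'n \<Rightarrow> real" where
  "mat_l1 A = (\<Sum>i\<in>UNIV. \<Sum>j\<in>UNIV. \<bar>A $ i $ j\<bar>)"

definition outer :: "real ^ 'n \<Rightarrow> real ^ 'n ^ 'n" where
  "outer u = (\<chi> i j. u $ i * u $ j)"

definition S_C :: "(real ^ 'n ^ 'n) set" where
  "S_C = {C. transpose C = C \<and> (\<forall>i j. 0 \<le> C $ i $ j) \<and> (\<Sum>i\<in>UNIV. \<Sum>j\<in>UNIV. C $ i $ j) = 1}"

definition S_u :: "(real ^ 'n) set" where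
  "S_u = {u. vec_l1 u = 1}"

definition mc_objective :: "real ^ 'n ^ 'n \<Rightarrow> real ^ 'n \<Rightarrow> real ^ 'n \<Rightarrow> real" where
  "mc_objective C us u =
     (\<Sum>i\<in>UNIV. \<Sum>j\<in>UNIV. C $ i $ j * (u $ i * u $ j - us $ i * us $ j)\<^sup>2)"

definition mc_lifted :: "real ^ 'n ^ 'n \<Rightarrow> real ^ 'n \<Rightarrow> real ^ 'n ^ 'n \<Rightarrow> real" where
  "mc_lifted C us M =
     (\<Sum>i\<in>UNIV. \<Sum>j\<in>UNIV. C $ i $ j * (M $ i $ j - us $ i * us $ j)\<^sup>2)"

definition degenerate_set :: "((real ^ 'n ^ 'n) \<times> (real ^ 'n)) set" where
  "degenerate_set = {(C, us). C \<in> S_C \<and> us \<in> S_u \<and>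
     (\<exists>u. mc_objective C us u = 0 \<and> outer u \<noteq> outer us)}"

(* In ereal, inverse 0 = \<infinity>, and the infimum over the empty set is \<infinity>, with inverse 0;
   the latter occurs for n = 1, where the degenerate set is empty. *)
definition complexity_metric :: "real \<Rightarrow> real ^ 'n ^ 'n \<Rightarrow> real ^ 'n \<Rightarrow> ereal" where
  "complexity_metric \<alpha> C us =
     inverse (INF (C', us') \<in> degenerate_set.
       ereal (\<alpha> * mat_l1 (C - C') + (1 - \<alpha>) * vec_l1 (us - us')))"

definition hessian :: "('a::real_normed_vector \<Rightarrow> real) \<Rightarrow> 'a \<Rightarrow> 'a \<Rightarrow> 'a \<Rightarrow> real" where
  "hessian f M K L = frechet_derivative (\<lambda>X. frechet_derivative f (at X) K) (at M) L"

lemma hessian_mc_lifted: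
  "hessian (mc_lifted C us) M K K = 2 * (\<Sum>i\<in>UNIV. \<Sum>j\<in>UNIV. C $ i $ j * (K $ i $ j)\<^sup>2)"
proof -
  have bl: "bounded_linear (\<lambda>M::real^'n^'n. M $ i $ j)" for i j
    using bounded_linear_compose[OF bounded_linear_vec_nth bounded_linear_vec_nth] .
  have d1: "(mc_lifted C us has_derivative
     (\<lambda>H. \<Sum>i\<in>UNIV. \<Sum>j\<in>UNIV. C $ i $ j * (2 * (X $ i $ j - us $ i * us $ j) * H $ i $ j))) (at X)" for X
    unfolding mc_lifted_def power2_eq_square
    by (auto intro!: derivative_eq_intros bounded_linear.has_derivative[OF bl] sum.cong ext
        simp: algebra_simps)
  have e1: "(\<lambda>X. frechet_derivative (mc_lifted C us) (at X) K) =
     (\<lambda>X. \<Sum>i\<in>UNIV. \<Sum>j\<in>UNIV. C $ i $ j * (2 * (X $ i $ j - us $ i * us $ j) * K $ i $ j))"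
    by (simp add: frechet_derivative_at[OF d1, symmetric])
  have d2: "((\<lambda>X. \<Sum>i\<in>UNIV. \<Sum>j\<in>UNIV. C $ i $ j * (2 * (X $ i $ j - us $ i * us $ j) * K $ i $ j))
     has_derivative (\<lambda>H. \<Sum>i\<in>UNIV. \<Sum>j\<in>UNIV. C $ i $ j * (2 * H $ i $ j * K $ i $ j))) (at M)"
    by (auto intro!: derivative_eq_intros bounded_linear.has_derivative[OF bl] sum.cong ext
        simp: algebra_simps)
  show ?thesis
    unfolding hessian_def e1 frechet_derivative_at[OF d2, symmetric]
    by (simp add: sum_distrib_left power2_eq_square algebra_simps)
qed

(* The norm on real ^ 'n ^ 'n is the Frobenius norm.  Since c2 / 0 = 0 here, the ratio
   condition forces c1 > 0 for \<delta> in [0,1). *)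
definition rip22 :: "real \<Rightarrow> (real ^ 'n ^ 'n \<Rightarrow> real) \<Rightarrow> bool" where
  "rip22 \<delta> f \<longleftrightarrow> (\<exists>c1 c2. 0 \<le> c1 \<and> 0 \<le> c2 \<and> c2 / c1 = (1 + \<delta>) / (1 - \<delta>) \<and>
     (\<forall>M K. rank M \<le> 2 \<and> rank K \<le> 2 \<longrightarrow>
        c1 * (norm K)\<^sup>2 \<le> hessian f M K K \<and> hessian f M K K \<le> c2 * (norm K)\<^sup>2))"

definition mc_rip22 :: "real \<Rightarrow> real ^ 'n ^ 'n \<Rightarrow> real ^ 'n \<Rightarrow> bool" where
  "mc_rip22 \<delta> C us \<longleftrightarrow> rip22 \<delta> (mc_lifted C us)"

definition incoherent :: "real \<Rightarrow> real ^ 'n \<Rightarrow> bool" where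
  "incoherent \<mu> u \<longleftrightarrow> (\<forall>i. \<bar>u $ i\<bar> \<le> sqrt (\<mu> / real CARD('n)) * norm u)"

end

(* Let (C', us') be degenerate with witness u, let S be the support of us', k = card S, let z be the
   number of zero entries of C' and t the l1-distance of us and us'.  Testing the RIP on matrix units
   bounds the entries of C from below by eta = (1 - delta) / ((1 + delta) n^2), so C and C' differ by
   at least 2 eta z.  Incoherence bounds the entries of us by mu / n, so t >= 2 (1 - k mu / n).
   Finally z >= max k (2 k - 2), which follows by looking at the ratios r = u / us' on S: entry (i, j)
   vanishes unless r_i r_j = 1.  If all these products are 1, then u is nonzero at some a outside S
   and the entries joining a to S vanish; otherwise the bad pairs in S are counted. *)
theory Submission
  imports Defs
begin

section \<open>Counting pairs of ratios whose product is not 1\<close>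

text \<open>Two indices form a good pair only if their ratios are mutually inverse. Either some
  ratio \<open>r a\<close> differs from its own inverse, and the indices split into those with ratio
  \<open>r a\<close>, those with its inverse and the rest; or every ratio is 1 or -1, and the bad
  pairs are those of opposite sign.\<close>

lemma max_card_le_card_bad_pairs:
  fixes r :: "'a \<Rightarrow> real"
  assumes fin: "finite S"
    and ne: "{(i, j) \<in> S \<times> S. r i * r j \<noteq> 1} \<noteq> {}"
  shows "max (card S) (2 * card S - 2) \<le> card {(i, j) \<in> S \<times> S. r i * r j \<noteq> 1}"
    (is "_ \<le> card ?B")
proof -
  have finB: "finite ?B"
    using fin by (auto intro: finite_subset[of _ "S \<times> S"])
  show ?thesis
  proof (cases "\<exists>i\<in>S. r i * r i \<noteq> 1")
    case True
    then obtain a where a: "a \<in> S" "r a * r a \<noteq> 1" by blast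
    define P where "P = {j \<in> S. r j = r a}"
    define Q where "Q = {j \<in> S. r a * r j = 1}"
    define R where "R = S - (P \<union> Q)"
    have finPQR: "finite P" "finite Q" "finite R"
      using fin by (auto simp: P_def Q_def R_def)
    have PQ: "P \<inter> Q = {}" using a by (auto simp: P_def Q_def)
    have R: "(P \<union> Q) \<inter> R = {}" by (auto simp: R_def)
    have S: "S = (P \<union> Q) \<union> R" by (auto simp: P_def Q_def R_def)
    have "card S = card (P \<union> Q) + card R"
      using R finPQR by (subst S, subst card_Un_disjoint) auto
    also have "card (P \<union> Q) = card P + card Q"
      using PQ finPQR by (subst card_Un_disjoint) auto
    finally have cS: "card S = card P + card Q + card R" .
    have "P \<noteq> {}" using a by (auto simp: P_def)
    then have p: "card P \<ge> 1" using finPQR by (simp add: Suc_le_eq card_gt_0_iff)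
    have bad: "r i * r j \<noteq> 1"
      if "(i, j) \<in> P \<times> P \<or> (i, j) \<in> Q \<times> Q \<or> (i, j) \<in> (P \<union> Q) \<times> R" for i j
    proof
      assume e: "r i * r j = 1"
      have inv: "r i = inverse (r j)" if "r i * r j = 1" for i j
        using that by (metis inverse_unique mult.commute)
      from that e a show False
        by (auto simp: P_def Q_def R_def) (metis inv mult.commute inverse_inverse_eq)+
    qed
    \<comment> \<open>Pairs inside \<open>R\<close> may be good or bad and are left out of the
      count.\<close>
    have sub: "(P \<times> P \<union> Q \<times> Q) \<union> ((P \<union> Q) \<times> R \<union> R \<times> (P \<union> Q)) \<subseteq> ?B"
    proof -
      have "(i, j) \<in> ?B" if "(i, j) \<in> R \<times> (P \<union> Q)" for i j
        using bad[of j i] that S by (auto simp: mult.commute)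
      then show ?thesis using bad S by blast
    qed
    have "card ((P \<times> P \<union> Q \<times> Q) \<union> ((P \<union> Q) \<times> R \<union> R \<times> (P \<union> Q))) =
        card (P \<times> P \<union> Q \<times> Q) + card ((P \<union> Q) \<times> R \<union> R \<times> (P \<union> Q))"
      using R finPQR by (subst card_Un_disjoint) auto
    also have "card (P \<times> P \<union> Q \<times> Q) = card P * card P + card Q * card Q"
      using PQ finPQR by (subst card_Un_disjoint) (auto simp: card_cartesian_product)
    also have "card ((P \<union> Q) \<times> R \<union> R \<times> (P \<union> Q)) = 2 * (card P + card Q) * card R"
      using PQ R finPQR
      by (subst card_Un_disjoint)
        (auto simp: card_cartesian_product card_Un_disjoint algebra_simps)
    finally have le: "card P * card P + card Q * card Q + 2 * (card P + card Q) * card R \<le> card ?B"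
      using card_mono[OF finB sub] by simp
    \<comment> \<open>In \<open>int\<close> the subtractions below are not truncated.\<close>
    define p q s where "p = int (card P)" and "q = int (card Q)" and "s = int (card R)"
    have pqs: "p \<ge> 1" "q \<ge> 0" "s \<ge> 0" using p by (auto simp: p_def q_def s_def)
    have "p + q + s \<le> p * p + q * q + 2 * (p + q) * s"
    proof -
      have "0 \<le> p * (p - 1)" "0 \<le> (p - 1) * s" "0 \<le> q * s" using pqs by auto
      moreover have "0 \<le> q * (q - 1)" using pqs by (cases "q = 0") auto
      moreover have "p * p + q * q + 2 * (p + q) * s - (p + q + s) =
          p * (p - 1) + q * (q - 1) + 2 * ((p - 1) * s) + 2 * (q * s) + s"
        by (simp add: algebra_simps)
      ultimately show ?thesis using pqs by linarith
    qed
    moreover have "2 * (p + q + s) - 2 \<le> p * p + q * q + 2 * (p + q) * s"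
    proof -
      \<comment> \<open>This nonnegative expression is exactly the difference of the two sides. It
        vanishes at \<open>p = q = 1\<close>, \<open>s = 0\<close>, so the constant 2 cannot be
        lowered in this count.\<close>
      have "0 \<le> (p - 1)\<^sup>2 + (q - 1)\<^sup>2 + 2 * (p + q - 1) * s" using pqs by auto
      then show ?thesis by (simp add: power2_eq_square algebra_simps)
    qed
    moreover have "p * p + q * q + 2 * (p + q) * s \<le> int (card ?B)"
      using of_nat_mono[OF le, where 'a = int] by (simp add: p_def q_def s_def)
    moreover have "int (card S) = p + q + s" using cS by (simp add: p_def q_def s_def)
    ultimately have "int (card S) \<le> int (card ?B)" "2 * int (card S) - 2 \<le> int (card ?B)"
      by simp_all
    then show ?thesis unfolding max.bounded_iff by linarith
  next
    case False
    then have pm: "r i = 1 \<or> r i = -1" if "i \<in> S" for i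
      using that by (metis square_eq_1_iff)
    define P where "P = {j \<in> S. r j = 1}"
    define Q where "Q = {j \<in> S. r j = -1}"
    have fPQ: "finite P" "finite Q" using fin by (auto simp: P_def Q_def)
    have PQ: "P \<inter> Q = {}" by (auto simp: P_def Q_def)
    have S: "S = P \<union> Q" using pm by (auto simp: P_def Q_def)
    have cS: "card S = card P + card Q"
      using PQ fPQ by (subst S, subst card_Un_disjoint) auto
    obtain i j where "i \<in> S" "j \<in> S" "r i * r j \<noteq> 1" using ne by blast
    then have "P \<noteq> {}" "Q \<noteq> {}" using pm[of i] pm[of j] by (auto simp: P_def Q_def)
    then have p: "card P \<ge> 1" "card Q \<ge> 1"
      using fPQ by (simp_all add: Suc_le_eq card_gt_0_iff)
    have "P \<times> Q \<union> Q \<times> P \<subseteq> ?B" by (auto simp: P_def Q_def)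
    then have "card (P \<times> Q \<union> Q \<times> P) \<le> card ?B"
      by (intro card_mono finB)
    moreover have "card (P \<times> Q \<union> Q \<times> P) = 2 * (card P * card Q)"
      using PQ fPQ by (subst card_Un_disjoint) (auto simp: card_cartesian_product)
    moreover have "card P + card Q \<le> card P * card Q + 1"
    proof -
      obtain a b where "card P = Suc a" "card Q = Suc b" using p by (metis Suc_le_D One_nat_def)
      then show ?thesis by simp
    qed
    ultimately show ?thesis using cS p by simp
  qed
qed

section \<open>Entrywise consequences of RIP and incoherence\<close>

text \<open>On a matrix unit the Hessian is twice one entry of \<open>C\<close>, so all entries lie
  between \<open>c1 / 2\<close> and \<open>c2 / 2\<close>. Since the entries sum to 1,
  \<open>c2\<close> cannot be too small, and the fixed ratio of \<open>c2\<close> to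
  \<open>c1\<close> carries this over to \<open>c1\<close>.\<close>

lemma entry_ge_of_rip:
  fixes C :: "real ^ 'n ^ 'n"
  assumes "mc_rip22 \<delta> C us" "0 \<le> \<delta>" "\<delta> < 1" "C \<in> S_C"
  shows "(1 - \<delta>) / ((1 + \<delta>) * (real CARD('n))\<^sup>2) \<le> C $ i $ j"
proof -
  obtain c1 c2 where c: "0 \<le> c1" "0 \<le> c2" "c2 / c1 = (1 + \<delta>) / (1 - \<delta>)"
    and h: "\<And>M K. rank M \<le> 2 \<Longrightarrow> rank K \<le> 2 \<Longrightarrow>
        c1 * (norm K)\<^sup>2 \<le> hessian (mc_lifted C us) M K K \<and>
        hessian (mc_lifted C us) M K K \<le> c2 * (norm K)\<^sup>2"
    using assms(1) unfolding mc_rip22_def rip22_def by blast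
  have entry: "c1 \<le> 2 * C $ i $ j \<and> 2 * C $ i $ j \<le> c2" for i j
  proof -
    define K :: "real ^ 'n ^ 'n" where "K = axis i (axis j 1)"
    have "row a K = (if a = i then axis j 1 else 0)" for a
      by (simp add: row_def K_def axis_def vec_eq_iff)
    then have "rows K \<subseteq> {0, axis j 1}" by (auto simp: rows_def)
    \<comment> \<open>The zero row is counted too; the bound 2 is all that RIP asks for.\<close>
    then have "rank K \<le> card {0, axis j (1::real)}"
      unfolding row_rank_def by (intro dim_le_card order.trans[OF _ span_superset]) auto
    also have "\<dots> \<le> 2" by (simp add: card_insert_if)
    finally have rk: "rank K \<le> 2" .
    have nm: "norm K = 1" by (simp add: K_def norm_eq_sqrt_inner inner_axis_axis)
    have K: "K $ a $ b = (if a = i \<and> b = j then 1 else 0)" for a b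
      by (simp add: K_def axis_def)
    have "(\<Sum>a\<in>UNIV. \<Sum>b\<in>UNIV. C $ a $ b * (K $ a $ b)\<^sup>2) =
        (\<Sum>a\<in>UNIV. if a = i then C $ i $ j else 0)"
      by (intro sum.cong refl) (auto simp: K if_distrib[of "\<lambda>x. x\<^sup>2"] if_distrib[of "(*) _"] cong: if_cong)
    then have "hessian (mc_lifted C us) K K K = 2 * C $ i $ j"
      by (simp add: hessian_mc_lifted)
    with h[OF rk rk] nm show ?thesis by simp
  qed
  let ?n = "real CARD('n)"
  have n: "0 < (1 + \<delta>) * ?n\<^sup>2" using assms by simp
  have pos: "(1 + \<delta>) / (1 - \<delta>) > 0" using assms by simp
  then have "c1 \<noteq> 0" using c by auto
  then have c2: "c2 = c1 * ((1 + \<delta>) / (1 - \<delta>))" using c by (simp add: field_simps)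
  have "1 = (\<Sum>i\<in>UNIV. \<Sum>j\<in>UNIV. C $ i $ j)" using assms(4) by (simp add: S_C_def)
  also have "\<dots> \<le> (\<Sum>i\<in>(UNIV::'n set). \<Sum>j\<in>(UNIV::'n set). c2 / 2)"
    using entry by (intro sum_mono) (simp add: field_simps)
  also have "\<dots> = ?n\<^sup>2 * (c2 / 2)" by (simp add: power2_eq_square)
  finally have "1 \<le> ?n\<^sup>2 * (c1 * ((1 + \<delta>) / (1 - \<delta>)) / 2)" by (simp add: c2)
  then have "(1 - \<delta>) / ((1 + \<delta>) * ?n\<^sup>2) \<le> c1 / 2"
    using assms(2,3) n by (simp add: pos_divide_le_eq) (simp add: field_simps)
  then show ?thesis using entry[of i j] by linarith
qed

text \<open>With \<open>m\<close> the largest absolute entry and l1-norm 1, the squared Euclidean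
  norm is at most \<open>m\<close>. Squaring the incoherence bound at the largest entry then gives a
  quadratic inequality in \<open>m\<close>, from which one factor \<open>m\<close> cancels.\<close>

lemma abs_entry_le_of_incoherent:
  fixes us :: "real ^ 'n"
  assumes inc: "incoherent \<mu> us" and us: "us \<in> S_u" and mu: "0 \<le> \<mu>"
  shows "\<bar>us $ i\<bar> \<le> \<mu> / real CARD('n)"
proof -
  define m where "m = Max (range (\<lambda>i. \<bar>us $ i\<bar>))"
  have le: "\<bar>us $ i\<bar> \<le> m" for i unfolding m_def by (intro Max_ge) auto
  have "m \<in> range (\<lambda>i. \<bar>us $ i\<bar>)" unfolding m_def by (intro Max_in) auto
  then obtain k where k: "m = \<bar>us $ k\<bar>" by blast
  have "(norm us)\<^sup>2 = (\<Sum>i\<in>UNIV. \<bar>us $ i\<bar> * \<bar>us $ i\<bar>)"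
    unfolding power2_norm_eq_inner by (simp add: inner_vec_def)
  also have "\<dots> \<le> (\<Sum>i\<in>UNIV. m * \<bar>us $ i\<bar>)"
    using le by (intro sum_mono mult_right_mono) auto
  also have "\<dots> = m" using us by (simp add: sum_distrib_left[symmetric] S_u_def vec_l1_def)
  finally have nm: "(norm us)\<^sup>2 \<le> m" .
  have "m \<le> sqrt (\<mu> / real CARD('n)) * norm us" using inc k by (simp add: incoherent_def)
  then have "m\<^sup>2 \<le> (sqrt (\<mu> / real CARD('n)) * norm us)\<^sup>2"
    using k by (intro power_mono) auto
  also have "\<dots> = \<mu> / real CARD('n) * (norm us)\<^sup>2" using mu by (simp add: power_mult_distrib)
  also have "\<dots> \<le> \<mu> / real CARD('n) * m" using nm mu by (intro mult_left_mono) auto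
  finally have "m * m \<le> \<mu> / real CARD('n) * m" by (simp add: power2_eq_square)
  moreover have "0 \<le> m" "0 \<le> \<mu> / real CARD('n)" using k mu by auto
  ultimately have "m \<le> \<mu> / real CARD('n)" by (metis mult_right_le_imp_le order_le_less)
  then show ?thesis using le[of i] by linarith
qed

section \<open>Zero entries of a degenerate instance\<close>

lemma zero_entries_of_degenerate:
  fixes C :: "real ^ 'n ^ 'n" and us :: "real ^ 'n"
  assumes "(C, us) \<in> degenerate_set"
  defines "S \<equiv> {i. us $ i \<noteq> 0}"
  shows "max (card S) (2 * card S - 2) \<le> card {(i, j). C $ i $ j = 0}" (is "_ \<le> card ?Z")
proof -
  obtain u where C: "C \<in> S_C" and g: "mc_objective C us u = 0" and ne: "outer u \<noteq> outer us"
    using assms by (auto simp: degenerate_set_def)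
  have nn: "0 \<le> C $ i $ j" for i j using C by (simp add: S_C_def)
  \<comment> \<open>A vanishing sum of nonnegative terms vanishes term by term, so the weight must
    be zero wherever the two products differ.\<close>
  have Z: "(i, j) \<in> ?Z" if "u $ i * u $ j \<noteq> us $ i * us $ j" for i j
  proof -
    have "C $ i $ j * (u $ i * u $ j - us $ i * us $ j)\<^sup>2 = 0"
      using g nn unfolding mc_objective_def
      by (subst (asm) sum_nonneg_eq_0_iff; simp add: sum_nonneg sum_nonneg_eq_0_iff)+
    then show ?thesis using that by auto
  qed
  define r where "r i = u $ i / us $ i" for i
  let ?B = "{(i, j) \<in> S \<times> S. r i * r j \<noteq> 1}"
  have BZ: "?B \<subseteq> ?Z" using Z by (fastforce simp: r_def S_def)
  show ?thesis
  proof (cases "?B = {}")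
    case False
    then show ?thesis
      using max_card_le_card_bad_pairs[of S r] card_mono[OF _ BZ] by fastforce
  next
    case True
    then have eq: "u $ i * u $ j = us $ i * us $ j" if "i \<in> S" "j \<in> S" for i j
    proof -
      have "r i * r j = 1" using True that by blast
      then show ?thesis using that by (simp add: r_def S_def field_simps)
    qed
    obtain i j where ij: "u $ i * u $ j \<noteq> us $ i * us $ j"
      using ne by (auto simp: outer_def vec_eq_iff)
    then have "i \<notin> S \<or> j \<notin> S" using eq by blast
    then have "us $ i * us $ j = 0" by (auto simp: S_def)
    \<comment> \<open>Here \<open>u $ i * u $ j\<close> is nonzero, so both factors are;
      \<open>a\<close> is whichever of the two indices lies outside \<open>S\<close>.\<close>
    then obtain a where a: "a \<notin> S" "u $ a \<noteq> 0"
      using ij \<open>i \<notin> S \<or> j \<notin> S\<close> by auto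
    have "u $ j \<noteq> 0" if "j \<in> S" for j using eq[OF that that] that by (auto simp: S_def)
    then have "{a} \<times> S \<union> S \<times> {a} \<subseteq> ?Z" using a Z by (auto simp: S_def)
    then have "card ({a} \<times> S \<union> S \<times> {a}) \<le> card ?Z"
      by (intro card_mono) simp_all
    moreover have "card ({a} \<times> S \<union> S \<times> {a}) = 2 * card S"
      using a by (subst card_Un_disjoint) (auto simp: card_cartesian_product)
    ultimately show ?thesis by simp
  qed
qed

section \<open>Lower bounds for the distance to a degenerate instance\<close>

text \<open>Both matrices have total mass 1, so the mass of \<open>C\<close> lost at the zeros of
  \<open>C'\<close> must reappear elsewhere and is counted twice. Formally, adding the zero-sum
  differences to their absolute values makes every term nonnegative and at least
  \<open>2 * \<eta>\<close> at a zero of \<open>C'\<close>.\<close>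

lemma mat_l1_diff_ge_zero_entries:
  fixes C C' :: "real ^ 'n ^ 'n"
  assumes "C \<in> S_C" "C' \<in> S_C" and eta: "\<And>i j. \<eta> \<le> C $ i $ j"
  shows "2 * \<eta> * real (card {(i, j). C' $ i $ j = 0}) \<le> mat_l1 (C - C')"
proof -
  let ?f = "\<lambda>(i, j). C $ i $ j" and ?g = "\<lambda>(i, j). C' $ i $ j"
  let ?Z = "{(i, j). C' $ i $ j = 0}"
  have f: "sum ?f UNIV = 1" and g: "sum ?g UNIV = 1"
    using assms by (simp_all add: S_C_def sum.cartesian_product UNIV_Times_UNIV[symmetric] del: UNIV_Times_UNIV)
  have "mat_l1 (C - C') = (\<Sum>p\<in>UNIV. \<bar>?f p - ?g p\<bar>)"
    by (simp add: mat_l1_def sum.cartesian_product case_prod_unfold)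
  also have "\<dots> = (\<Sum>p\<in>UNIV. \<bar>?f p - ?g p\<bar> + (?f p - ?g p))"
    using f g by (simp only: sum.distrib sum_subtractf)
  also have "\<dots> \<ge> (\<Sum>p\<in>?Z. \<bar>?f p - ?g p\<bar> + (?f p - ?g p))"
    by (intro sum_mono2) auto
  also have "(\<Sum>p\<in>?Z. \<bar>?f p - ?g p\<bar> + (?f p - ?g p)) \<ge> (\<Sum>p\<in>?Z. 2 * \<eta>)"
  proof (intro sum_mono)
    fix p assume "p \<in> ?Z"
    then show "2 * \<eta> \<le> \<bar>?f p - ?g p\<bar> + (?f p - ?g p)"
      using eta[of "fst p" "snd p"] by (auto split: prod.splits)
  qed
  finally show ?thesis by (simp add: mult.commute)
qed

text \<open>The same double counting of mass, applied to absolute values: off the support of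
  \<open>us'\<close> each term is twice the entry of \<open>us\<close>, and on it the triangle
  inequality gives nonnegativity. The bound \<open>b\<close> limits how much mass of
  \<open>us\<close> the support can hold.\<close>

lemma vec_l1_diff_ge_support:
  fixes us us' :: "real ^ 'n"
  assumes "us \<in> S_u" "us' \<in> S_u" and b: "\<And>i. \<bar>us $ i\<bar> \<le> b"
  shows "2 * (1 - real (card {i. us' $ i \<noteq> 0}) * b) \<le> vec_l1 (us - us')"
proof -
  let ?S = "{i. us' $ i \<noteq> 0}"
  have 1: "(\<Sum>i\<in>UNIV. \<bar>us $ i\<bar>) = 1" "(\<Sum>i\<in>UNIV. \<bar>us' $ i\<bar>) = 1"
    using assms by (simp_all add: S_u_def vec_l1_def)
  have "2 * (\<Sum>i\<in>- ?S. \<bar>us $ i\<bar>) =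
      (\<Sum>i\<in>- ?S. \<bar>us $ i - us' $ i\<bar> + (\<bar>us $ i\<bar> - \<bar>us' $ i\<bar>))"
    by (simp add: sum_distrib_left)
  also have "\<dots> \<le> (\<Sum>i\<in>UNIV. \<bar>us $ i - us' $ i\<bar> + (\<bar>us $ i\<bar> - \<bar>us' $ i\<bar>))"
    by (intro sum_mono2) auto
  also have "\<dots> = vec_l1 (us - us')"
    using 1 by (simp add: vec_l1_def sum.distrib sum_subtractf)
  finally have 2: "2 * (\<Sum>i\<in>- ?S. \<bar>us $ i\<bar>) \<le> vec_l1 (us - us')" .
  have 3: "(\<Sum>i\<in>- ?S. \<bar>us $ i\<bar>) = 1 - (\<Sum>i\<in>?S. \<bar>us $ i\<bar>)"
    using sum.subset_diff[of ?S UNIV "\<lambda>i. \<bar>us $ i\<bar>"] 1 by (simp add: Compl_eq_Diff_UNIV)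
  have "(\<Sum>i\<in>?S. \<bar>us $ i\<bar>) \<le> real (card ?S) * b"
    using sum_bounded_above[of ?S "\<lambda>i. \<bar>us $ i\<bar>" b] b by simp
  then have "2 * (1 - real (card ?S) * b) \<le> 2 * (1 - (\<Sum>i\<in>?S. \<bar>us $ i\<bar>))"
    by (simp only: mult_le_cancel_left) simp
  with 2 3 show ?thesis by simp
qed

section \<open>Extended real arithmetic and the final estimate\<close>

lemma min_inverse_ereal:
  assumes "0 \<le> x" "0 \<le> y"
  shows "min (inverse (ereal x)) (inverse (ereal y)) = inverse (ereal (max x y))"
  using assms ereal_inverse_antimono[of "ereal x" "ereal y"] ereal_inverse_antimono[of "ereal y" "ereal x"]
  by (auto simp: min_def max_def antisym)

lemma max_inverse_ereal:
  assumes "0 \<le> x" "0 \<le> y"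
  shows "max (inverse (ereal x)) (inverse (ereal y)) = inverse (ereal (min x y))"
  using assms ereal_inverse_antimono[of "ereal x" "ereal y"] ereal_inverse_antimono[of "ereal y" "ereal x"]
  by (auto simp: min_def max_def antisym)

theorem theorem3p2:
  fixes C :: "real ^ 'n ^ 'n" and us :: "real ^ 'n" and \<alpha> \<delta> \<mu> :: real
  assumes "0 \<le> \<alpha>" "\<alpha> \<le> 1"
    and "0 \<le> \<delta>" "\<delta> < 1"
    and "1 \<le> \<mu>" "\<mu> \<le> real CARD('n)"
    and "C \<in> S_C" "us \<in> S_u"
    and "mc_rip22 \<delta> C us"
    and "incoherent \<mu> us"
  shows "complexity_metric \<alpha> C us \<le>
    max (ereal (real CARD('n) * (1 + \<delta>)) / ereal (4 * \<alpha> * (1 - \<delta>)))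
        (1 / ereal (2 * (1 - \<alpha>) * \<mu>)) *
    min (inverse (ereal (1 / \<mu> - 1 / real CARD('n)))) (ereal (3 * \<mu>))"
proof -
  let ?n = "real CARD('n)"
  define \<eta> where "\<eta> = (1 - \<delta>) / ((1 + \<delta>) * ?n\<^sup>2)"
  \<comment> \<open>\<open>A\<close> and \<open>B\<close> are the reciprocals of the two arguments
    of the maximum, and \<open>x\<close> is that of the minimum; a zero value encodes an infinite
    bound. Thus it suffices to bound the distance below by \<open>min A B * x\<close>.\<close>
  define A where "A = 4 * \<alpha> * \<eta> * ?n"
  define B where "B = 2 * (1 - \<alpha>) * \<mu>"
  define x where "x = max (1 / \<mu> - 1 / ?n) (1 / (3 * \<mu>))"
  have n: "?n > 0" by simp
  have eta: "\<eta> > 0" using assms n by (simp add: \<eta>_def)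
  have AB: "A \<ge> 0" "B \<ge> 0" using assms eta by (simp_all add: A_def B_def)
  have xpos: "x > 0" using assms by (simp add: x_def less_max_iff_disj)
  have A_eq: "A = 4 * \<alpha> * (1 - \<delta>) / (?n * (1 + \<delta>))"
    using n by (simp add: A_def \<eta>_def power2_eq_square mult_ac)
  have rhs1: "max (ereal (?n * (1 + \<delta>)) / ereal (4 * \<alpha> * (1 - \<delta>)))
        (1 / ereal (2 * (1 - \<alpha>) * \<mu>)) = inverse (ereal (min A B))"
  proof -
    have "ereal (?n * (1 + \<delta>)) / ereal (4 * \<alpha> * (1 - \<delta>)) = inverse (ereal A)"
    proof (cases "\<alpha> = 0")
      case True
      then have "A = 0" by (simp add: A_def)
      with True show ?thesis using assms by (simp add: divide_ereal_def zero_ereal_def[symmetric])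
    next
      case False
      then have "4 * \<alpha> * (1 - \<delta>) \<noteq> 0" "A \<noteq> 0"
        using assms n eta by (auto simp: A_def)
      then show ?thesis by (simp add: A_eq)
    qed
    moreover have "1 / ereal (2 * (1 - \<alpha>) * \<mu>) = inverse (ereal B)"
      by (simp add: B_def divide_ereal_def)
    ultimately show ?thesis using max_inverse_ereal[OF AB] by simp
  qed
  have rhs2: "min (inverse (ereal (1 / \<mu> - 1 / ?n))) (ereal (3 * \<mu>)) = inverse (ereal x)"
  proof -
    have "ereal (3 * \<mu>) = inverse (ereal (1 / (3 * \<mu>)))" using assms by simp
    moreover have "1 / \<mu> - 1 / ?n \<ge> 0" "1 / (3 * \<mu>) \<ge> 0" using assms by (simp_all add: frac_le)
    ultimately show ?thesis using min_inverse_ereal unfolding x_def by metis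
  qed
  \<comment> \<open>Positivity of \<open>x\<close> makes its inverse finite and positive, so the
    case \<open>m = 0\<close> reads \<infinity> on both sides.\<close>
  have rhs: "inverse (ereal m) * inverse (ereal x) = inverse (ereal (m * x))" for m
    using xpos by (cases "m = 0") (auto simp: zero_ereal_def[symmetric])
  have key: "min A B * x \<le> \<alpha> * mat_l1 (C - C') + (1 - \<alpha>) * vec_l1 (us - us')"
    if D: "(C', us') \<in> degenerate_set" for C' us'
  proof -
    define z where "z = real (card {(i, j). C' $ i $ j = 0})"
    define k where "k = real (card {i. us' $ i \<noteq> 0})"
    define t where "t = vec_l1 (us - us')"
    have C': "C' \<in> S_C" and us': "us' \<in> S_u" using D by (auto simp: degenerate_set_def)
    have m: "2 * \<eta> * z \<le> mat_l1 (C - C')"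
      unfolding z_def \<eta>_def
      using mat_l1_diff_ge_zero_entries[OF assms(7) C']
        entry_ge_of_rip[OF assms(9,3,4,7)] by blast
    have t: "2 * (1 - k * (\<mu> / ?n)) \<le> t"
      unfolding k_def t_def using assms
      by (intro vec_l1_diff_ge_support us' abs_entry_le_of_incoherent) auto
    have t0: "0 \<le> t" by (simp add: t_def vec_l1_def sum_nonneg)
    have z: "k \<le> z" "2 * k - 2 \<le> z"
      using zero_entries_of_degenerate[OF D] unfolding k_def z_def by linarith+
    have q: "0 \<le> \<mu> / ?n" using assms by simp
    have "k * (\<mu> / ?n) \<le> z * (\<mu> / ?n)" "(2 * k - 2) * (\<mu> / ?n) \<le> z * (\<mu> / ?n)"
      using z q by (intro mult_right_mono; simp)+
    \<comment> \<open>The first bound adds \<open>z \<ge> 2 * k - 2\<close> to the bound on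
      \<open>t\<close>, and \<open>k\<close> cancels. For the second, with y =
      \<open>k * (\<mu> / ?n)\<close>, the sum is at least y and at least 2 - y, hence at least 1;
      the value 2/3 is what the constant \<open>3 * \<mu>\<close> calls for.\<close>
    then have w: "2 * (1 - \<mu> / ?n) \<le> z * (\<mu> / ?n) + t" "2 / 3 \<le> z * (\<mu> / ?n) + t"
      using t t0 by (simp_all add: algebra_simps)
    have "1 / \<mu> - 1 / ?n = 2 * (1 - \<mu> / ?n) / (2 * \<mu>)"
      using assms(5) n by (simp add: field_simps)
    also have "\<dots> \<le> (z * (\<mu> / ?n) + t) / (2 * \<mu>)"
      using w(1) assms(5) by (intro divide_right_mono) auto
    finally have x1: "1 / \<mu> - 1 / ?n \<le> (z * (\<mu> / ?n) + t) / (2 * \<mu>)" .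
    have "1 / (3 * \<mu>) = 2 / 3 / (2 * \<mu>)"
      using assms(5) by (simp add: field_simps)
    also have "\<dots> \<le> (z * (\<mu> / ?n) + t) / (2 * \<mu>)"
      using w(2) assms(5) by (intro divide_right_mono) auto
    finally have "x \<le> (z * (\<mu> / ?n) + t) / (2 * \<mu>)"
      using x1 unfolding x_def by (intro max.boundedI)
    also have "\<dots> = z / (2 * ?n) + t / (2 * \<mu>)"
      using assms n by (simp add: field_simps)
    finally have "min A B * x \<le> min A B * (z / (2 * ?n)) + min A B * (t / (2 * \<mu>))"
      using AB by (metis distrib_left min.boundedI mult_left_mono)
    \<comment> \<open>Replacing the minimum by \<open>A\<close> in one term and by \<open>B\<close>
      in the other turns them into the matrix and vector parts of the distance.\<close>
    also have "\<dots> \<le> A * (z / (2 * ?n)) + B * (t / (2 * \<mu>))"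
      using t0 assms by (intro add_mono mult_right_mono) (auto simp: z_def)
    also have "\<dots> = \<alpha> * (2 * \<eta> * z) + (1 - \<alpha>) * t"
      using n assms by (simp add: A_def B_def field_simps)
    also have "\<dots> \<le> \<alpha> * mat_l1 (C - C') + (1 - \<alpha>) * t"
      using m assms by (simp add: mult_left_mono)
    finally show ?thesis by (simp add: t_def)
  qed
  have "complexity_metric \<alpha> C us \<le> inverse (ereal (min A B * x))"
    unfolding complexity_metric_def
    using AB xpos key by (intro ereal_inverse_antimono INF_greatest) auto
  then show ?thesis unfolding rhs1 rhs2 rhs .
qed

end
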